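(* For every integer $j\ge2$, the Berger measure of the Agler $j$-th shift $A_j$ is $(j-1)(1-r)^{j-2}\,dr$ on $[0,1]$.
   Context: A unilateral weighted shift $W_\omega$ with bounded positive weights $\omega=\{\omega_n\}_{n\ge0}$ acts on $\ell^2(\mathbb{Z}_+)$ by $W_\omega e_n=\omega_ne_{n+1}$; its moments are $\gamma_0=1$, $\gamma_k=\omega_0^2\cdots\omega_{k-1}^2$ ($k\ge1$). The Berger measure of a subnormal $W_\omega$ is the probability measure $\sigma$ on $[0,\|W_\omega\|^2]$ with $\gamma_k=\int r^kd\sigma(r)$ for all $k\ge0$; such a measure exists if and only if $W_\omega$ is subnormal. The Agler $j$-th shift $A_j$ is the unilateral weighted shift with weights $\sqrt{\frac{n+1}{n+j}}$, $n\ge0$ (so $A_2$ is the Bergman shift). *)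

theory Defs
  imports "HOL-Probability.Probability"
begin

definition ell2 :: "(nat \<Rightarrow> complex) set" where
  "ell2 = {x. summable (\<lambda>n. (cmod (x n))\<^sup>2)}"

definition ell2_norm :: "(nat \<Rightarrow> complex) \<Rightarrow> real" where
  "ell2_norm x = sqrt (\<Sum>n. (cmod (x n))\<^sup>2)"

text \<open>Coordinate form of the operator sending \<open>e n\<close> to \<open>\<omega> n \<cdot> e (n + 1)\<close>.\<close>

definition weighted_shift :: "(nat \<Rightarrow> real) \<Rightarrow> (nat \<Rightarrow> complex) \<Rightarrow> nat \<Rightarrow> complex" where
  "weighted_shift \<omega> x n = (case n of 0 \<Rightarrow> 0 | Suc m \<Rightarrow> complex_of_real (\<omega> m) * x m)"

text \<open>The operator norm; meaningful only for bounded weights, since \<open>Sup\<close> on the reals is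
  unspecified for unbounded sets.\<close>

definition shift_norm :: "(nat \<Rightarrow> real) \<Rightarrow> real" where
  "shift_norm \<omega> = (SUP x \<in> {x \<in> ell2. ell2_norm x \<le> 1}. ell2_norm (weighted_shift \<omega> x))"

definition shift_moment :: "(nat \<Rightarrow> real) \<Rightarrow> nat \<Rightarrow> real" where
  "shift_moment \<omega> k = (\<Prod>i<k. (\<omega> i)\<^sup>2)"

text \<open>By Berger's theorem such a \<open>\<sigma>\<close> exists if and only if the shift is subnormal, so subnormality
  is not a separate condition here. The condition on \<open>sets \<sigma>\<close> also fixes the underlying space of
  \<open>\<sigma>\<close> to be the interval.\<close>

definition is_Berger_measure :: "(nat \<Rightarrow> real) \<Rightarrow> real measure \<Rightarrow> bool" where
  "is_Berger_measure \<omega> \<sigma> \<longleftrightarrow>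
     (\<forall>n. 0 < \<omega> n) \<and> bdd_above (range \<omega>) \<and>
     prob_space \<sigma> \<and>
     sets \<sigma> = sets (restrict_space borel {0..(shift_norm \<omega>)\<^sup>2}) \<and>
     (\<forall>k. shift_moment \<omega> k = (\<integral>r. r ^ k \<partial>\<sigma>))"

definition agler_weight :: "nat \<Rightarrow> nat \<Rightarrow> real" where
  "agler_weight j n = sqrt (real (n + 1) / real (n + j))"

end

theory Submission
  imports Defs
begin

text \<open>
  A shift has at most one Berger measure, because a probability measure on a bounded interval is
  determined by its moments (\<open>Berger_measure_unique\<close>). It therefore suffices to check that
  \<open>(j - 1) (1 - r) ^ (j - 2) dr\<close> on \<open>[0, 1]\<close> is a Berger measure of the Agler shift
  (\<open>is_Berger_measure_agler\<close>).

  Moment determinacy goes through characteristic functions: on a bounded support the moments are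
  bounded by a geometric sequence, so the Taylor series of the characteristic function at \<open>0\<close>
  converges everywhere and its coefficients are the moments. Levy's uniqueness theorem finishes the
  argument.

  Two things remain for the Agler shift. The interval \<open>[0, \<parallel>A\<parallel>\<^sup>2]\<close> is \<open>[0, 1]\<close>, because
  the norm of a weighted shift is the supremum of its weights and these increase to \<open>1\<close>. The
  moments agree by induction on \<open>k\<close>: integrating by parts, the \<open>(k+1)\<close>-st and \<open>k\<close>-th moments of the
  density have ratio \<open>(k + 1) / (k + j)\<close>, which is the square of the \<open>k\<close>-th weight.
\<close>

section \<open>The norm of a weighted shift\<close>

text \<open>The shift multiplies the squared coordinates by \<open>(\<omega> n)\<^sup>2\<close> before moving them, which bounds
  its norm by the supremum; the basis vectors show that the bound is the best possible.\<close>

lemma shift_norm_eq_SUP: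
  assumes nonneg: "\<And>n. 0 \<le> \<omega> n" and bdd: "bdd_above (range \<omega>)"
  shows "shift_norm \<omega> = (SUP n. \<omega> n)"
proof -
  define c where "c = (SUP n. \<omega> n)"
  let ?B = "{x \<in> ell2. ell2_norm x \<le> 1}"
  have le_c: "\<omega> n \<le> c" for n
    unfolding c_def using bdd by (rule cSUP_upper[rotated]) simp
  have c_nonneg: "0 \<le> c"
    using nonneg[of 0] le_c[of 0] by linarith
  have norm_shift: "ell2_norm (weighted_shift \<omega> x) = sqrt (\<Sum>n. (\<omega> n)\<^sup>2 * (cmod (x n))\<^sup>2)"
    and summable_shift: "summable (\<lambda>n. (\<omega> n)\<^sup>2 * (cmod (x n))\<^sup>2)" if "x \<in> ell2" for x
  proof -
    have "summable (\<lambda>n. c\<^sup>2 * (cmod (x n))\<^sup>2)"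
      using that by (simp add: ell2_def)
    then show *: "summable (\<lambda>n. (\<omega> n)\<^sup>2 * (cmod (x n))\<^sup>2)"
      by (rule summable_comparison_test') (auto intro!: mult_right_mono power_mono nonneg le_c)
    have shifted: "(cmod (weighted_shift \<omega> x (Suc n)))\<^sup>2 = (\<omega> n)\<^sup>2 * (cmod (x n))\<^sup>2" for n
      by (simp add: weighted_shift_def norm_mult power_mult_distrib)
    have "summable (\<lambda>n. (cmod (weighted_shift \<omega> x n))\<^sup>2)"
      by (subst summable_Suc_iff[symmetric]) (simp add: shifted *)
    from suminf_split_head[OF this]
    have "(\<Sum>n. (cmod (weighted_shift \<omega> x n))\<^sup>2) = (\<Sum>n. (\<omega> n)\<^sup>2 * (cmod (x n))\<^sup>2)"
      unfolding shifted by (simp add: weighted_shift_def)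
    then show "ell2_norm (weighted_shift \<omega> x) = sqrt (\<Sum>n. (\<omega> n)\<^sup>2 * (cmod (x n))\<^sup>2)"
      by (simp add: ell2_norm_def)
  qed
  have upper: "ell2_norm (weighted_shift \<omega> x) \<le> c" if x: "x \<in> ?B" for x
  proof -
    have sx: "summable (\<lambda>n. (cmod (x n))\<^sup>2)" and nx: "(\<Sum>n. (cmod (x n))\<^sup>2) \<le> 1"
      using x by (auto simp: ell2_def ell2_norm_def)
    have "(\<Sum>n. (\<omega> n)\<^sup>2 * (cmod (x n))\<^sup>2) \<le> (\<Sum>n. c\<^sup>2 * (cmod (x n))\<^sup>2)"
      using x sx by (intro suminf_le summable_shift mult_right_mono power_mono nonneg le_c) auto
    also have "\<dots> = c\<^sup>2 * (\<Sum>n. (cmod (x n))\<^sup>2)"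
      using sx by (simp add: suminf_mult)
    also have "\<dots> \<le> c\<^sup>2"
      using nx by (simp add: mult_left_le)
    finally show ?thesis
      using x c_nonneg by (simp add: norm_shift real_le_lsqrt)
  qed
  have lower: "\<exists>x\<in>?B. \<omega> n \<le> ell2_norm (weighted_shift \<omega> x)" for n
  proof
    \<comment> \<open>The \<open>n\<close>-th basis vector is mapped to a vector of norm exactly \<open>\<omega> n\<close>.\<close>
    let ?e = "\<lambda>k. if k = n then 1 else (0::complex)"
    have sq: "(cmod (?e k))\<^sup>2 = (if k = n then 1 else 0)" for k
      by simp
    have e: "?e \<in> ell2"
      unfolding ell2_def mem_Collect_eq sq by simp
    have "ell2_norm ?e = 1"
      unfolding ell2_norm_def sq using sums_single[of n "\<lambda>_. 1::real"] by (simp add: sums_iff)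
    with e show "?e \<in> ?B" by simp
    have "(\<lambda>k. (\<omega> k)\<^sup>2 * (cmod (?e k))\<^sup>2) = (\<lambda>k. if k = n then (\<omega> k)\<^sup>2 else 0)"
      by (auto simp: fun_eq_iff)
    with e show "\<omega> n \<le> ell2_norm (weighted_shift \<omega> ?e)"
      using sums_single[of n "\<lambda>k. (\<omega> k)\<^sup>2"] by (simp add: norm_shift sums_iff nonneg)
  qed
  have "shift_norm \<omega> = c"
    unfolding shift_norm_def
  proof (rule antisym)
    show "(SUP x\<in>?B. ell2_norm (weighted_shift \<omega> x)) \<le> c"
      using lower upper by (intro cSUP_least) blast+
    show "c \<le> (SUP x\<in>?B. ell2_norm (weighted_shift \<omega> x))"
      unfolding c_def
    proof (rule cSUP_mono)
      show "bdd_above ((\<lambda>x. ell2_norm (weighted_shift \<omega> x)) ` ?B)"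
        using upper by (intro bdd_aboveI2)
    qed (use lower in auto)
  qed
  then show ?thesis by (simp add: c_def)
qed

section \<open>Uniqueness of the Berger measure\<close>

text \<open>The remainder of the \<open>n\<close>-th Taylor polynomial of the characteristic function at \<open>t\<close> is at most
  \<open>2 (\<bar>t\<bar> b) ^ n / n!\<close> when the support lies in \<open>[-b, b]\<close>. The Taylor polynomials depend on the
  moments only, hence so does their limit.\<close>

lemma real_distribution_eqI_moments:
  assumes M: "real_distribution M" and N: "real_distribution N"
    and bM: "AE x in M. \<bar>x\<bar> \<le> b" and bN: "AE x in N. \<bar>x\<bar> \<le> b"
    and moments: "\<And>k. (\<integral>x. x ^ k \<partial>M) = (\<integral>x. x ^ k \<partial>N)"
  shows "M = N"
proof (rule Levy_uniqueness[OF M N], rule ext)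
  fix t :: real
  let ?S = "\<lambda>P n. \<Sum>k\<le>n. ((\<i> * t) ^ k / fact k) * complex_of_real (\<integral>x. x ^ k \<partial>P)"
  have lim: "(\<lambda>n. ?S P n) \<longlonglongrightarrow> char P t"
    if P: "real_distribution P" and bP: "AE x in P. \<bar>x\<bar> \<le> b" for P
  proof -
    interpret real_distribution P by (rule P)
    have pow: "AE x in P. \<bar>x\<bar> ^ n \<le> b ^ n" for n
      using bP by eventually_elim (simp add: power_mono)
    have int: "integrable P (\<lambda>x. x ^ n)" for n
      using pow[of n] by (intro integrable_const_bound[where B = "b ^ n"]) (auto simp: power_abs)
    have bound: "(\<integral>x. \<bar>x\<bar> ^ n \<partial>P) \<le> b ^ n" for n
    proof -
      have "(\<integral>x. \<bar>x\<bar> ^ n \<partial>P) \<le> (\<integral>x. b ^ n \<partial>P)"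
        using int[of n] pow[of n] by (intro integral_mono_AE) (auto simp flip: power_abs)
      then show ?thesis by (simp add: prob_space[unfolded space_eq_univ])
    qed
    have error: "cmod (?S P n - char P t) \<le> 2 * ((\<bar>t\<bar> * b) ^ n /\<^sub>R fact n)" for n
    proof -
      have "cmod (char P t - ?S P n) \<le> (2 * \<bar>t\<bar> ^ n / fact n) * (\<integral>x. \<bar>x\<bar> ^ n \<partial>P)"
        using int by (rule char_approx1)
      also have "\<dots> \<le> (2 * \<bar>t\<bar> ^ n / fact n) * b ^ n"
        by (intro mult_left_mono bound) simp
      finally show ?thesis
        by (simp add: norm_minus_commute power_mult_distrib field_simps)
    qed
    have "(\<lambda>n. 2 * ((\<bar>t\<bar> * b) ^ n /\<^sub>R fact n)) \<longlonglongrightarrow> 0"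
      using tendsto_mult_right_zero[OF summable_LIMSEQ_zero[OF summable_exp_generic]] by blast
    then have "(\<lambda>n. ?S P n - char P t) \<longlonglongrightarrow> 0"
      by (rule Lim_null_comparison[OF always_eventually[OF allI[OF error]]])
    then show ?thesis by (rule LIM_zero_cancel)
  qed
  show "char M t = char N t"
    using lim[OF M bM] lim[OF N bN] by (simp add: moments LIMSEQ_unique)
qed

text \<open>Transfers uniqueness from the real line, where characteristic functions live, to measures whose
  underlying space is only an interval: restricting to a Borel set loses no measurable subset of it.\<close>

lemma measure_eqI_distr_borel:
  fixes S :: "'a::topological_space set"
  assumes S: "S \<in> sets borel"
    and M: "sets M = sets (restrict_space borel S)" and N: "sets N = sets (restrict_space borel S)"
    and eq: "distr M borel (\<lambda>x. x) = distr N borel (\<lambda>x. x)"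
  shows "M = N"
proof (rule measure_eqI)
  show "sets M = sets N" by (simp add: M N)
  fix A assume A: "A \<in> sets M"
  have id: "(\<lambda>x. x) \<in> measurable M borel" "(\<lambda>x. x) \<in> measurable N borel"
    using measurable_restrict_space1[OF measurable_ident_sets[OF refl]]
    by (auto simp: measurable_cong_sets[OF M refl] measurable_cong_sets[OF N refl])
  have borel: "A \<in> sets borel"
    using A S by (auto simp: M sets_restrict_space)
  have "A \<subseteq> space M" "A \<subseteq> space N"
    using A sets.sets_into_space[of A] by (auto simp: M N)
  then show "emeasure M A = emeasure N A"
    using arg_cong[OF eq, of "\<lambda>P. emeasure P A"] id borel
    by (simp add: emeasure_distr Int_absorb2)
qed

lemma Berger_measure_unique:
  assumes \<sigma>: "is_Berger_measure \<omega> \<sigma>" and \<tau>: "is_Berger_measure \<omega> \<tau>"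
  shows "\<sigma> = \<tau>"
proof -
  define b where "b = (shift_norm \<omega>)\<^sup>2"
  have push: "real_distribution (distr \<rho> borel (\<lambda>x. x))"
    "AE x in distr \<rho> borel (\<lambda>x. x). \<bar>x\<bar> \<le> b"
    "(\<integral>x. x ^ k \<partial>distr \<rho> borel (\<lambda>x. x)) = shift_moment \<omega> k"
    if \<rho>: "is_Berger_measure \<omega> \<rho>" for \<rho> :: "real measure" and k
  proof -
    interpret prob_space \<rho> using \<rho> by (simp add: is_Berger_measure_def)
    have sets: "sets \<rho> = sets (restrict_space borel {0..b})"
      using \<rho> by (simp add: is_Berger_measure_def b_def)
    have id: "(\<lambda>x. x) \<in> borel_measurable \<rho>"
      using measurable_restrict_space1[OF measurable_ident_sets[OF refl]]
      by (auto simp: measurable_cong_sets[OF sets refl])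
    show "real_distribution (distr \<rho> borel (\<lambda>x. x))"
      using id by (rule real_distribution_distr)
    have "space \<rho> = {0..b}"
      using sets_eq_imp_space_eq[OF sets] by (simp add: space_restrict_space)
    then show "AE x in distr \<rho> borel (\<lambda>x. x). \<bar>x\<bar> \<le> b"
      using id by (subst AE_distr_iff) auto
    show "(\<integral>x. x ^ k \<partial>distr \<rho> borel (\<lambda>x. x)) = shift_moment \<omega> k"
      using \<rho> id by (subst integral_distr) (auto simp: is_Berger_measure_def)
  qed
  have "distr \<sigma> borel (\<lambda>x. x) = distr \<tau> borel (\<lambda>x. x)"
    using \<sigma> \<tau> by (intro real_distribution_eqI_moments[where b = b]) (auto simp: push)
  moreover have "sets \<sigma> = sets (restrict_space borel {0..b})"
    and "sets \<tau> = sets (restrict_space borel {0..b})"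
    using \<sigma> \<tau> by (simp_all add: is_Berger_measure_def b_def)
  ultimately show ?thesis
    using measure_eqI_distr_borel[of "{0..b}" \<sigma> \<tau>] by simp
qed

section \<open>The Agler shifts\<close>

lemma SUP_agler_weight:
  assumes "j \<ge> 1"
  shows "bdd_above (range (agler_weight j))" and "(SUP n. agler_weight j n) = 1"
proof -
  have le: "agler_weight j n \<le> 1" for n
    using assms by (simp add: agler_weight_def)
  then show bdd: "bdd_above (range (agler_weight j))"
    by (intro bdd_aboveI2)
  have "(\<lambda>n. sqrt (real (n + 1) / real (n + j))) \<longlonglongrightarrow> 1"
    by real_asymp
  then have lim: "agler_weight j \<longlonglongrightarrow> 1"
    by (simp add: agler_weight_def[abs_def])
  have "1 \<le> (SUP n. agler_weight j n)"
    using lim by (rule LIMSEQ_le_const2) (auto intro!: cSUP_upper bdd)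
  moreover have "(SUP n. agler_weight j n) \<le> 1"
    by (intro cSUP_least) (auto simp: le)
  ultimately show "(SUP n. agler_weight j n) = 1" by simp
qed

text \<open>This recurrence for the Beta integral is integration by parts in the following form:
  \<open>r ^ (k + 1) * (1 - r) ^ (m + 1)\<close> vanishes at both ends of the interval, and writing one factor
  \<open>1 - r\<close> of its derivative as a difference leaves
  \<open>(k + 1) r ^ k (1 - r) ^ m - (k + m + 2) r ^ (k + 1) (1 - r) ^ m\<close>.\<close>

lemma integral_power_times_power_Suc:
  fixes m k :: nat
  defines "I \<equiv> \<lambda>k. LBINT r:{0..1::real}. r ^ k * (1 - r) ^ m"
  shows "real (k + m + 2) * I (Suc k) = real (k + 1) * I k"
proof -
  let ?F = "\<lambda>r::real. r ^ Suc k * (1 - r) ^ Suc m"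
  let ?f = "\<lambda>k r::real. r ^ k * (1 - r) ^ m"
  let ?g = "\<lambda>r. real (k + 1) * ?f k r - real (k + m + 2) * ?f (Suc k) r"
  have int: "set_integrable lborel {0..1} (?f k)" for k
    by (intro borel_integrable_atLeastAtMost' continuous_intros)
  have "(LBINT r:{0..1}. ?g r) = ?F 1 - ?F 0"
    unfolding set_lebesgue_integral_def
  proof (rule integral_FTC_Icc)
    fix x :: real
    have "(?F has_real_derivative
        real (Suc k) * x ^ k * (1 - x) ^ Suc m - x ^ Suc k * (real (Suc m) * (1 - x) ^ m)) (at x)"
      by (auto intro!: derivative_eq_intros simp del: power_Suc)
    moreover have "real (Suc k) * x ^ k * (1 - x) ^ Suc m - x ^ Suc k * (real (Suc m) * (1 - x) ^ m) = ?g x"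
      by (simp add: algebra_simps)
    ultimately have "(?F has_real_derivative ?g x) (at x)" by simp
    then show "(?F has_vector_derivative ?g x) (at x within {0..1})"
      by (simp add: has_real_derivative_iff_has_vector_derivative has_vector_derivative_at_within)
  qed (auto intro!: continuous_intros)
  moreover have "(LBINT r:{0..1}. ?g r) = real (k + 1) * I k - real (k + m + 2) * I (Suc k)"
    unfolding I_def
    by (subst set_integral_diff(2)) (intro set_integrable_mult_right int | simp only: set_integral_mult_right)+
  ultimately show ?thesis by simp
qed

lemma integral_power_one_minus: "(LBINT r:{0..1::real}. (1 - r) ^ m) = 1 / real (m + 1)"
proof -
  let ?F = "\<lambda>r::real. - ((1 - r) ^ Suc m / real (m + 1))"
  have "(LBINT r:{0..1::real}. (1 - r) ^ m) = ?F 1 - ?F 0"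
    unfolding set_lebesgue_integral_def
  proof (rule integral_FTC_Icc)
    fix x :: real
    have "(?F has_real_derivative (1 - x) ^ m) (at x)"
      by (auto intro!: derivative_eq_intros simp: add_pos_nonneg simp del: power_Suc)
    then show "(?F has_vector_derivative (1 - x) ^ m) (at x within {0..1})"
      by (simp add: has_real_derivative_iff_has_vector_derivative has_vector_derivative_at_within)
  qed (auto intro!: continuous_intros)
  then show ?thesis by simp
qed

text \<open>Both sides are multiplied by \<open>(k + 1) / (k + j)\<close> when \<open>k\<close> increases by one, so they are
  equal as soon as they are for \<open>k = 0\<close>; there the factor \<open>j - 1\<close> normalises the integral of
  \<open>(1 - r) ^ (j - 2)\<close>.\<close>

lemma shift_moment_agler_weight:
  assumes "j \<ge> 2"
  shows "shift_moment (agler_weight j) k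
    = (real j - 1) * (LBINT r:{0..1::real}. r ^ k * (1 - r) ^ (j - 2))"
proof (induction k)
  case 0
  then show ?case
    using assms by (simp add: shift_moment_def integral_power_one_minus of_nat_diff)
next
  case (Suc k)
  let ?I = "\<lambda>k. LBINT r:{0..1::real}. r ^ k * (1 - r) ^ (j - 2)"
  have "real (k + j) * ?I (Suc k) = real (k + 1) * ?I k"
    using integral_power_times_power_Suc[of k "j - 2"] assms by simp
  then have "?I (Suc k) = ?I k * (real (k + 1) / real (k + j))"
    using assms by (simp add: field_simps)
  moreover have "shift_moment (agler_weight j) (Suc k)
      = shift_moment (agler_weight j) k * (real (k + 1) / real (k + j))"
    by (simp add: shift_moment_def agler_weight_def)
  ultimately show ?case
    by (simp only: Suc.IH mult.assoc)
qed

lemma is_Berger_measure_agler: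
  assumes "j \<ge> 2"
  shows "is_Berger_measure (agler_weight j)
    (density (restrict_space lborel {0..1}) (\<lambda>r. ennreal ((real j - 1) * (1 - r) ^ (j - 2))))"
    (is "is_Berger_measure _ ?\<mu>")
proof -
  let ?f = "\<lambda>r::real. (real j - 1) * (1 - r) ^ (j - 2)"
  have pos: "0 < agler_weight j n" for n
    using assms by (simp add: agler_weight_def)
  have norm: "shift_norm (agler_weight j) = 1"
    using assms pos less_imp_le SUP_agler_weight[of j] by (subst shift_norm_eq_SUP) auto
  have meas: "g \<in> borel_measurable borel \<Longrightarrow> g \<in> borel_measurable (restrict_space lborel {0..1})"
    for g :: "real \<Rightarrow> real"
    by (simp add: measurable_restrict_space1)
  have nonneg: "0 \<le> ?f r" if "r \<in> {0..1}" for r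
    using that assms by simp
  have moment: "(\<integral>r. r ^ k \<partial>?\<mu>) = shift_moment (agler_weight j) k" for k
  proof -
    have "(\<integral>r. r ^ k \<partial>?\<mu>) = (\<integral>r. ?f r *\<^sub>R r ^ k \<partial>restrict_space lborel {0..1})"
      by (rule integral_density) (auto intro!: meas AE_I2 nonneg simp: space_restrict_space)
    also have "\<dots> = (LBINT r:{0..1}. ?f r *\<^sub>R r ^ k)"
      by (simp add: integral_restrict_space set_lebesgue_integral_def)
    also have "\<dots> = (LBINT r:{0..1}. (real j - 1) * (r ^ k * (1 - r) ^ (j - 2)))"
      by (simp add: mult_ac)
    also have "\<dots> = shift_moment (agler_weight j) k"
      using assms by (simp add: shift_moment_agler_weight)
    finally show ?thesis .
  qed
  \<comment> \<open>The total mass is the zeroth moment, and that is an empty product.\<close>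
  have "prob_space ?\<mu>"
  proof
    have "measure ?\<mu> (space ?\<mu>) = 1"
      using moment[of 0] by (simp add: shift_moment_def)
    then show "emeasure ?\<mu> (space ?\<mu>) = 1"
      by (cases "emeasure ?\<mu> (space ?\<mu>)" rule: ennreal_cases) (auto simp: measure_def)
  qed
  moreover have "sets ?\<mu> = sets (restrict_space borel {0..(shift_norm (agler_weight j))\<^sup>2})"
    by (simp add: norm sets_restrict_space)
  ultimately show ?thesis
    using pos moment assms SUP_agler_weight(1)[of j] by (simp add: is_Berger_measure_def)
qed

theorem corollary5p3:
  fixes j :: nat and \<sigma> :: "real measure"
  assumes "j \<ge> 2"
  shows "is_Berger_measure (agler_weight j) \<sigma> \<longleftrightarrow>
    \<sigma> = density (restrict_space lborel {0..1})
          (\<lambda>r. ennreal ((real j - 1) * (1 - r) ^ (j - 2)))"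
  using is_Berger_measure_agler[OF assms] Berger_measure_unique by blast

end
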